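(* Let $n=3$, let $N$ be the set of nonempty subsets of $\{1,2,3\}$, and let $C_J=1$ for all $J\in N$. Consider any one of the following three distributed index coding problems: (a) $A_1=\emptyset,\ A_2=\{3\},\ A_3=\{2\}$; (b) $A_1=\emptyset,\ A_2=\{1,3\},\ A_3=\{2\}$; (c) $A_1=\emptyset,\ A_2=\{1,3\},\ A_3=\{1,2\}$. Then every achievable rate tuple $(R_1,R_2,R_3)$ satisfies $$R_1+R_2+R_3\le 9 .$$ Moreover, this inequality is not implied by the polymatroidal outer bound: there is a tuple $(R_1,R_2,R_3)$ of nonnegative reals that satisfies the polymatroidal outer bound of the problem and has $R_1+R_2+R_3>9$.
   Context: Distributed index coding. $[n]=\{1,\dots,n\}$ and $N=\{J\subseteq[n] : J\neq\emptyset\}$. There are $n$ messages $x_j\in\{0,1\}^{t_j}$, $j\in[n]$ ($t_j$ nonnegative integers), and $n$ receivers; receiver $j$ wants $x_j$ and knows a priori the messages $x(A_j)=(x_i)_{i\in A_j}$, where $A_j\subseteq[n]\setminus\{j\}$. For each $J\in N$ there is a server holding exactly the messages $x_i$, $i\in J$; it broadcasts noiselessly to all receivers a sequence $y_J\in\{0,1\}^{u_J}$ ($u_J$ a nonnegative integer) that is a function of $(x_i)_{i\in J}$. Receiver $j$ must recover $x_j$ exactly as a function of $(y_J)_{J\in N}$ and $x(A_j)$, for every realization of the messages. A code consists of such lengths, encoding functions and decoding functions. For given link capacities $C_J\ge 0$, a rate tuple $(R_j)_{j\in[n]}$ is achievable if there exist such a code and some $r>0$ with $R_j\le t_j/r$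 for all $j\in[n]$ and $C_J\ge u_J/r$ for all $J\in N$. Polymatroidal outer bound: with $B_j=[n]\setminus(A_j\cup\{j\})$, a tuple $(R_j)_{j\in[n]}$ satisfies the polymatroidal outer bound if for every $T\in N$ there is $f_T:2^T\to\mathbb{R}$ with $R_j\le f_T((B_j\cup\{j\})\cap T)-f_T(B_j\cap T)$ for all $j\in T$, where $f_T(\emptyset)=0$, $f_T(T)=\sum_{J\in N: J\cap T\ne\emptyset}C_J$, $f_T$ is nondecreasing with respect to inclusion, and $f_T$ is submodular, i.e. $f_T(A\cup B)+f_T(A\cap B)\le f_T(A)+f_T(B)$ for all $A,B\subseteq T$. *)

theory Defs
  imports Complex_Main "HOL-Library.FuncSet"
begin

text \<open>Messages and receivers are indexed by \<open>{1..n}\<close>, servers by the nonempty subsets of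
  \<open>{1..n}\<close>. The side information sets are a function \<open>A\<close> on \<open>{1..n}\<close>.\<close>

definition servers :: "nat \<Rightarrow> nat set set" where
  "servers n = {J. J \<subseteq> {1..n} \<and> J \<noteq> {}}"

definition messages :: "nat \<Rightarrow> (nat \<Rightarrow> nat) \<Rightarrow> (nat \<Rightarrow> bool list) set" where
  "messages n t = (\<Pi>\<^sub>E j\<in>{1..n}. {w. length w = t j})"

text \<open>That \<open>y\<^sub>J\<close> depends only on the messages indexed by \<open>J\<close>, and the output of decoder \<open>j\<close> only
  on the broadcasts and the messages indexed by \<open>A j\<close>, is enforced by \<^const>\<open>restrict\<close>, which
  forgets all other components.\<close>

definition broadcast ::
    "nat \<Rightarrow> (nat set \<Rightarrow> (nat \<Rightarrow> bool list) \<Rightarrow> bool list) \<Rightarrow> (nat \<Rightarrow> bool list) \<Rightarrow> nat set \<Rightarrow> bool list"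
  where "broadcast n enc x = (\<lambda>J\<in>servers n. enc J (restrict x J))"

definition index_code ::
    "nat \<Rightarrow> (nat \<Rightarrow> nat set) \<Rightarrow> (nat \<Rightarrow> nat) \<Rightarrow> (nat set \<Rightarrow> nat)
      \<Rightarrow> (nat set \<Rightarrow> (nat \<Rightarrow> bool list) \<Rightarrow> bool list)
      \<Rightarrow> (nat \<Rightarrow> (nat set \<Rightarrow> bool list) \<Rightarrow> (nat \<Rightarrow> bool list) \<Rightarrow> bool list) \<Rightarrow> bool"
  where
  "index_code n A t u enc dec \<longleftrightarrow>
    (\<forall>x\<in>messages n t.
      (\<forall>J\<in>servers n. length (broadcast n enc x J) = u J) \<and>
      (\<forall>j\<in>{1..n}. dec j (broadcast n enc x) (restrict x (A j)) = x j))"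

definition achievable ::
    "nat \<Rightarrow> (nat \<Rightarrow> nat set) \<Rightarrow> (nat set \<Rightarrow> real) \<Rightarrow> (nat \<Rightarrow> real) \<Rightarrow> bool"
  where
  "achievable n A C R \<longleftrightarrow>
    (\<exists>t u enc dec. \<exists>r::real. index_code n A t u enc dec \<and> r > 0 \<and>
      (\<forall>j\<in>{1..n}. R j \<le> real (t j) / r) \<and>
      (\<forall>J\<in>servers n. C J \<ge> real (u J) / r))"

definition interfering :: "nat \<Rightarrow> (nat \<Rightarrow> nat set) \<Rightarrow> nat \<Rightarrow> nat set" where
  "interfering n A j = {1..n} - (A j \<union> {j})"

definition submodular_on :: "'a set \<Rightarrow> ('a set \<Rightarrow> real) \<Rightarrow> bool" where
  "submodular_on T f \<longleftrightarrow> (\<forall>X\<subseteq>T. \<forall>Y\<subseteq>T. f (X \<union> Y) + f (X \<inter> Y) \<le> f X + f Y)"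

definition polymatroidal_bound ::
    "nat \<Rightarrow> (nat \<Rightarrow> nat set) \<Rightarrow> (nat set \<Rightarrow> real) \<Rightarrow> (nat \<Rightarrow> real) \<Rightarrow> bool"
  where
  "polymatroidal_bound n A C R \<longleftrightarrow>
    (\<forall>T\<in>servers n. \<exists>f::nat set \<Rightarrow> real.
      (\<forall>j\<in>T. R j \<le> f ((interfering n A j \<union> {j}) \<inter> T) - f (interfering n A j \<inter> T)) \<and>
      f {} = 0 \<and>
      f T = (\<Sum>J\<in>{J\<in>servers n. J \<inter> T \<noteq> {}}. C J) \<and>
      mono_on (Pow T) f \<and>
      submodular_on T f)"

end

theory Submission
  imports Defs
begin

text \<open>Upper bound: let \<open>x'\<close> be the message tuple \<open>x\<close> with \<open>x\<^sub>3\<close> replaced by a constant. The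
  broadcast of \<open>x\<close>, together with the broadcasts of the two servers \<open>{2,3}\<close> and \<open>{1,2,3}\<close> for \<open>x'\<close>,
  determines \<open>x\<close>: receiver 1 finds \<open>x\<^sub>1\<close>. This gives the entire broadcast of \<open>x'\<close>, since the servers
  \<open>{2}\<close> and \<open>{1,2}\<close> send the same for \<open>x\<close> and \<open>x'\<close>, while those of \<open>{1}\<close>, \<open>{3}\<close> and \<open>{1,3}\<close> are
  functions of \<open>x\<^sub>1\<close>. Hence receiver 2 finds \<open>x\<^sub>2\<close>, and finally receiver 3 finds \<open>x\<^sub>3\<close>. Counting, the
  total message length is at most that of nine links.

  Conversely, \<open>(2,4,4)\<close> satisfies the polymatroidal outer bound.\<close>

lemma servers_3:
  "servers 3 = {{1}, {2}, {3}, {1, 2}, {1, 3}, {2, 3}, {1, 2, 3}}"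
proof -
  have "{1..3::nat} = {1, 2, 3}" by auto
  then have "servers 3 = Pow {1, 2, 3} - {{}}" by (auto simp: servers_def)
  also have "\<dots> = {{1}, {2}, {3}, {1, 2}, {1, 3}, {2, 3}, {1, 2, 3}}"
    by (simp add: Pow_insert insert_commute insert_Diff_if)
  finally show ?thesis .
qed

lemma finite_servers: "finite (servers n)"
  by (simp add: servers_def)

lemma decoding_unique:
  assumes "index_code n A t u enc dec" "x \<in> messages n t" "x' \<in> messages n t" "j \<in> {1..n}"
    and "broadcast n enc x = broadcast n enc x'"
    and "\<And>i. i \<in> A j \<Longrightarrow> x i = x' i"
  shows "x j = x' j"
proof -
  have "restrict x (A j) = restrict x' (A j)"
    using assms(6) by (auto simp: restrict_def)
  then show ?thesis
    using assms(1-5) unfolding index_code_def by metis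
qed

lemma broadcast_cong:
  assumes "\<And>i. i \<in> J \<Longrightarrow> x i = x' i"
  shows "broadcast n enc x J = broadcast n enc x' J"
proof -
  have "restrict x J = restrict x' J"
    using assms by (auto simp: restrict_def)
  then show ?thesis by (simp add: broadcast_def)
qed

lemma card_words: "card {w :: bool list. length w = k} = 2 ^ k"
  using card_lists_length_eq[of "UNIV :: bool set" k] by simp

lemma finite_words: "finite {w :: bool list. length w = k}"
  using finite_lists_length_eq[of "UNIV :: bool set" k] by simp

lemma card_word_families:
  "finite I \<Longrightarrow> card (\<Pi>\<^sub>E i\<in>I. {w :: bool list. length w = k i}) = 2 ^ (\<Sum>i\<in>I. k i)"
  by (simp add: card_PiE card_words power_sum)

text \<open>The map \<open>?h\<close> below is injective, and comparing cardinalities turns this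
  into a bound on bits. The inclusions treat all three problems at once, since every decoding step
  only needs agreement on a superset of the side information.\<close>

lemma index_code_length_bound:
  assumes code: "index_code 3 A t u enc dec"
    and A: "A 1 = {}" "A 2 \<subseteq> {1, 3}" "A 3 \<subseteq> {1, 2}"
  shows "t 1 + t 2 + t 3 \<le> (\<Sum>J\<in>servers 3. u J) + u {2, 3} + u {1, 2, 3}"
proof -
  let ?M = "messages 3 t" and ?y = "broadcast 3 enc"
  let ?W = "\<lambda>k. {w :: bool list. length w = k}"
  \<comment> \<open>The constant has length \<open>t 3\<close>, so the modified tuple is again a
    message tuple and the code must be correct on it.\<close>
  let ?c = "\<lambda>x :: nat \<Rightarrow> bool list. x(3 := replicate (t 3) False)"
  let ?h = "\<lambda>x. (?y x, ?y (?c x) {2, 3}, ?y (?c x) {1, 2, 3})"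
  let ?K = "(\<Pi>\<^sub>E J\<in>servers 3. ?W (u J)) \<times> ?W (u {2, 3}) \<times> ?W (u {1, 2, 3})"
  have I: "{1..3::nat} = {1, 2, 3}" by auto
  have c: "?c x \<in> ?M" if "x \<in> ?M" for x
    using that by (auto simp: messages_def PiE_iff extensional_def)
  have "?h ` ?M \<subseteq> ?K"
  proof -
    have "?y x \<in> (\<Pi>\<^sub>E J\<in>servers 3. ?W (u J))" if "x \<in> ?M" for x
      using that code by (auto simp: index_code_def PiE_iff broadcast_def)
    then show ?thesis
      using c by (force simp: PiE_iff servers_3)
  qed
  moreover have "inj_on ?h ?M"
  proof (rule inj_onI)
    fix x x' assume x: "x \<in> ?M" and x': "x' \<in> ?M" and eq: "?h x = ?h x'"
    note decode = decoding_unique[OF code]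
    have y: "?y x = ?y x'" using eq by simp
    have x1: "x 1 = x' 1"
      using decode[OF x x', of 1] y A(1) by simp
    have "?y (?c x) = ?y (?c x')"
    proof
      fix J
      consider "J \<notin> servers 3" | "J \<in> {{1}, {3}, {1, 3}}" | "J \<in> {{2}, {1, 2}}"
        | "J \<in> {{2, 3}, {1, 2, 3}}"
        by (auto simp: servers_3)
      then show "?y (?c x) J = ?y (?c x') J"
      proof cases
        case 1
        then show ?thesis by (simp add: broadcast_def)
      next
        case 2
        then show ?thesis using x1 by (intro broadcast_cong) auto
      next
        case 3
        then have "?y (?c z) J = ?y z J" for z by (intro broadcast_cong) auto
        then show ?thesis using y by simp
      next
        case 4
        then show ?thesis using eq by auto
      qed
    qed
    \<comment> \<open>Receiver 2 decodes the modified tuples: their third components agree by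
      construction, although \<open>x 3 = x' 3\<close> is not yet known.\<close>
    then have x2: "x 2 = x' 2"
      using decode[OF c[OF x] c[OF x'], of 2] A(2) x1 by fastforce
    have x3: "x 3 = x' 3"
      using decode[OF x x', of 3] y A(3) x1 x2 by fastforce
    show "x = x'"
      using x x' unfolding messages_def
      by (rule PiE_ext) (unfold I, use x1 x2 x3 in blast)
  qed
  moreover have "finite ?K"
    by (intro finite_cartesian_product finite_PiE finite_servers finite_words)
  ultimately have "card ?M \<le> card ?K"
    by (intro card_inj_on_le)
  moreover have "card ?M = 2 ^ (t 1 + t 2 + t 3)"
    using card_word_families[of "{1..3}" t] unfolding messages_def I by (simp add: add.assoc)
  moreover have "card ?K = 2 ^ ((\<Sum>J\<in>servers 3. u J) + u {2, 3} + u {1, 2, 3})"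
    by (simp add: card_cartesian_product card_word_families finite_servers card_words power_add)
  ultimately show ?thesis by simp
qed

lemma card_servers_3: "card (servers 3) = 7"
proof -
  have "servers 3 = Pow {1..3} - {{}}" by (auto simp: servers_def)
  then show ?thesis by (simp add: card_Diff_subset card_Pow)
qed

text \<open>Every link carries at most \<open>r\<close> bits. The seven links count once each, and
  those of \<open>{2, 3}\<close> and \<open>{1, 2, 3}\<close> once more, which gives nine.\<close>

lemma achievable_sum_rate_le_9:
  assumes ach: "achievable 3 A C R" and C: "\<And>J. J \<in> servers 3 \<Longrightarrow> C J = 1"
    and A: "A 1 = {}" "A 2 \<subseteq> {1, 3}" "A 3 \<subseteq> {1, 2}"
  shows "R 1 + R 2 + R 3 \<le> 9"
proof -
  obtain t u enc dec r where code: "index_code 3 A t u enc dec" and r: "r > 0"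
    and R: "\<And>j. j \<in> {1..3} \<Longrightarrow> R j \<le> real (t j) / r"
    and u: "\<And>J. J \<in> servers 3 \<Longrightarrow> C J \<ge> real (u J) / r"
    using ach unfolding achievable_def by blast
  have ur: "real (u J) \<le> r" if "J \<in> servers 3" for J
    using u[OF that] C[OF that] r by (simp add: field_simps)
  have "(\<Sum>J\<in>servers 3. real (u J)) \<le> 7 * r"
    using sum_bounded_above[of "servers 3" "\<lambda>J. real (u J)" r] ur by (simp add: card_servers_3)
  moreover have "real (u {2, 3}) \<le> r" "real (u {1, 2, 3}) \<le> r"
    by (rule ur; simp add: servers_3)+
  moreover have "real (t 1 + t 2 + t 3) \<le> real ((\<Sum>J\<in>servers 3. u J) + u {2, 3} + u {1, 2, 3})"
    using index_code_length_bound[OF code A] by (rule of_nat_mono)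
  ultimately have "real (t 1) + real (t 2) + real (t 3) \<le> 9 * r" by simp
  then have "real (t 1) / r + real (t 2) / r + real (t 3) / r \<le> 9"
    using r by (simp add: field_simps)
  then show ?thesis using R[of 1] R[of 2] R[of 3] by simp
qed

text \<open>Receivers 2 and 3 know each other's messages, so neither interferes with the other. Each
  may claim the full value 4 of its singleton even if \<open>f\<close> gives \<open>{2, 3}\<close>
  less than 8; thus the rates can sum to 10 while \<open>f T\<close> is at most 7.\<close>

lemma polymatroidal_bound_2_4_4:
  assumes C: "\<And>J. J \<in> servers 3 \<Longrightarrow> C J = 1"
    and A: "A 1 = {}" "A 2 = {3} \<or> A 2 = {1, 3}" "A 3 = {2} \<or> A 3 = {1, 2}"
  shows "polymatroidal_bound 3 A C (\<lambda>j. if j = 1 then 2 else 4)"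
  unfolding polymatroidal_bound_def
proof
  fix T assume T: "T \<in> servers 3"
  \<comment> \<open>All \<open>T\<close> use the same function up to the constants \<open>a\<close> and \<open>k\<close>, which adjust \<open>f T\<close>.\<close>
  define a k :: real where "a = (if 2 \<in> T \<or> 3 \<in> T then 2 else 4)" and "k = (if 1 \<in> T then 5 else 6)"
  \<comment> \<open>A modular function plus a nonnegative modular function truncated at
    \<open>k\<close>: both are monotone and submodular.\<close>
  define g h where "g X = (if 1 \<in> X then a else 0)"
    and "h X = min k ((if 2 \<in> X then 4 else 0) + (if 3 \<in> X then 4 else 0))" for X :: "nat set"
  define f where "f X = g X + h X" for X
  have ak: "a \<ge> 0" "k \<ge> 4" by (simp_all add: a_def k_def)
  have B: "interfering 3 A 1 = {2, 3}"
      "interfering 3 A 2 = {} \<or> interfering 3 A 2 = {1}"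
      "interfering 3 A 3 = {} \<or> interfering 3 A 3 = {1}"
    using A unfolding interfering_def by auto
  let ?N = "{J\<in>servers 3. J \<inter> T \<noteq> {}}"
  \<comment> \<open>Count by complement: the sets missing \<open>T\<close>, including the empty one,
    are the subsets of its complement.\<close>
  have "?N = Pow {1..3} - Pow ({1..3} - T)"
    by (auto simp: servers_def)
  also have "card \<dots> = 8 - 2 ^ (3 - card T)"
    using T by (subst card_Diff_subset)
      (auto simp: servers_def card_Pow card_Diff_subset finite_subset)
  finally have "card ?N = 8 - 2 ^ (3 - card T)" .
  then have total: "(\<Sum>J\<in>?N. C J) = real (8 - 2 ^ (3 - card T))"
    using C by simp
  \<comment> \<open>The choice of \<open>a\<close> and \<open>k\<close> yields 4 on singletons, 6 on
    pairs and 7 on the whole set.\<close>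
  have "f T = real (8 - 2 ^ (3 - card T))"
    using T unfolding servers_3 by (elim insertE emptyE; simp add: f_def g_def h_def a_def k_def)
  moreover have "\<forall>j\<in>T. (if j = 1 then 2 else 4) \<le>
      f ((interfering 3 A j \<union> {j}) \<inter> T) - f (interfering 3 A j \<inter> T)"
  proof
    fix j assume j: "j \<in> T"
    then consider "j = 1" | "j = 2" | "j = 3"
      using T unfolding servers_3 by fastforce
    then show "(if j = 1 then 2 else 4) \<le>
        f ((interfering 3 A j \<union> {j}) \<inter> T) - f (interfering 3 A j \<inter> T)"
    proof cases
      case 1
      then show ?thesis using j unfolding \<open>j = 1\<close> B(1) by (simp add: f_def g_def h_def a_def k_def)
    next
      case 2
      from B(2) show ?thesis by (rule disjE) (use j 2 in \<open>simp_all add: f_def g_def h_def k_def\<close>)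
    next
      case 3
      from B(3) show ?thesis by (rule disjE) (use j 3 in \<open>simp_all add: f_def g_def h_def k_def\<close>)
    qed
  qed
  moreover have "f {} = 0" using ak by (simp add: f_def g_def h_def)
  moreover have "mono_on (Pow T) f"
  proof (rule mono_onI)
    fix X Y :: "nat set" assume "X \<subseteq> Y"
    then have "g X \<le> g Y" and "h X \<le> h Y"
      unfolding g_def h_def using ak(1) by (auto intro!: min.mono add_mono)
    then show "f X \<le> f Y" by (simp add: f_def)
  qed
  moreover have "submodular_on T f"
  proof -
    have "g (X \<union> Y) + g (X \<inter> Y) = g X + g Y" for X Y
      by (simp add: g_def)
    moreover have "h (X \<union> Y) + h (X \<inter> Y) \<le> h X + h Y" for X Y
      using ak by (cases "2 \<in> X"; cases "2 \<in> Y"; cases "3 \<in> X"; cases "3 \<in> Y";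
        simp add: h_def)
    ultimately have "f (X \<union> Y) + f (X \<inter> Y) \<le> f X + f Y" for X Y
      unfolding f_def by (smt (verit))
    then show ?thesis by (simp add: submodular_on_def)
  qed
  ultimately show "\<exists>f::nat set \<Rightarrow> real.
      (\<forall>j\<in>T. (if j = 1 then 2 else 4) \<le>
        f ((interfering 3 A j \<union> {j}) \<inter> T) - f (interfering 3 A j \<inter> T)) \<and>
      f {} = 0 \<and> f T = (\<Sum>J\<in>{J\<in>servers 3. J \<inter> T \<noteq> {}}. C J) \<and>
      mono_on (Pow T) f \<and> submodular_on T f"
    using total by metis
qed

theorem mainTheorem4:
  fixes A :: "nat \<Rightarrow> nat set" and C :: "nat set \<Rightarrow> real"
  assumes "\<forall>J\<in>servers 3. C J = 1"
    and "(A 1 = {} \<and> A 2 = {3} \<and> A 3 = {2}) \<or>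
         (A 1 = {} \<and> A 2 = {1, 3} \<and> A 3 = {2}) \<or>
         (A 1 = {} \<and> A 2 = {1, 3} \<and> A 3 = {1, 2})"
  shows "(\<forall>R. achievable 3 A C R \<longrightarrow> R 1 + R 2 + R 3 \<le> 9) \<and>
         (\<exists>R. (\<forall>j\<in>{1..3}. R j \<ge> 0) \<and> polymatroidal_bound 3 A C R \<and> R 1 + R 2 + R 3 > 9)"
proof
  show "\<forall>R. achievable 3 A C R \<longrightarrow> R 1 + R 2 + R 3 \<le> 9"
    using assms achievable_sum_rate_le_9[of A C] by auto
  have "polymatroidal_bound 3 A C (\<lambda>j. if j = 1 then 2 else 4)"
    using assms by (intro polymatroidal_bound_2_4_4) auto
  then show "\<exists>R. (\<forall>j\<in>{1..3}. R j \<ge> 0) \<and> polymatroidal_bound 3 A C R \<and> R 1 + R 2 + R 3 > 9"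
    by (intro exI[of _ "\<lambda>j. if j = 1 then 2 else 4"]) simp
qed

end
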